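(* Let $X,Y,Z$ be Banach spaces, $F:X\rightrightarrows Y$ and $G:X\times Y\rightrightarrows Z$ be two multifunctions, and $(\overline{x},\overline{y},\overline{z})\in X\times Y\times Z$ be such that $(\overline{x},\overline{y})\in\operatorname{Gr}F$ and $((\overline{x},\overline{y}),\overline{z})\in\operatorname{Gr}G$. Suppose that $\operatorname{Gr}F$ and $\operatorname{Gr}G$ are locally closed around $(\overline{x},\overline{y})$ and $((\overline{x},\overline{y}),\overline{z})$, respectively. Let $\Phi:X\rightrightarrows Z$ be given by $$\Phi(x):=G(x,F(x))=\bigcup_{y\in F(x)}G(x,y)\quad\text{for every }x\in X.$$ (A) Suppose moreover that: (i) $G$ is Lipschitz-like with respect to $x$ uniformly in $y$ around $((\overline{x},\overline{y}),\overline{z})$ with constant $D\geq0$; (ii) $G$ is open at linear rate with respect to $y$ uniformly in $x$ around $((\overline{x},\overline{y}),\overline{z})$ with constant $C>0$; (iii) $F$ is open at linear rate $L>0$ around $(\overline{x},\overline{y})$; (iv) $LC-D>0$. Then there exists $\varepsilon>0$ such that, for every $\rho\in(0,\varepsilon)$ and every $(x,y,z)\in B(\overline{x},\varepsilon)\times B(\overline{y},\varepsilon)\times B(\overline{z},\varepsilon)$ such that $y\in F(x)$ and $z\in G(x,y)$, $$B(z,(LC-D)\rho)\subset\Phi(B(x,\rho)).$$ Moreover, if (with this $\varepsilon$) $G$ satisfies the condition that for every $x\in B(\overline{x},\varepsilon)$, $$G(x,y)\cap G(x,y')=\emptyset\quad\text{if }y\neq y',$$ then there exists $\varepsilon'>0$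 such that, for every $\rho\in(0,\varepsilon')$ and every $(x,z)\in\operatorname{Gr}\Phi\cap[B(\overline{x},\varepsilon')\times B(\overline{z},\varepsilon')]$, one has $B(z,(LC-D)\rho)\subset\Phi(B(x,\rho))$. (B) Suppose (instead of the assumptions in (A)) that: (i) $G$ is open at linear rate with respect to $x$ uniformly in $y$ around $((\overline{x},\overline{y}),\overline{z})$ with constant $C>0$; (ii) $G$ is Lipschitz-like with respect to $y$ uniformly in $x$ around $((\overline{x},\overline{y}),\overline{z})$ with constant $D\geq0$; (iii) $F$ is Lipschitz-like around $(\overline{x},\overline{y})$ with constant $M>0$; (iv) $C-MD>0$. Then there exists $\varepsilon>0$ such that, for every $\rho\in(0,\varepsilon)$ and every $(x,y,z)\in B(\overline{x},\varepsilon)\times B(\overline{y},\varepsilon)\times B(\overline{z},\varepsilon)$ such that $y\in F(x)$ and $z\in G(x,y)$, $$B(z,(C-MD)\rho)\subset\Phi(B(x,\rho)).$$ If, moreover, $F$ is Lipschitz around $(\overline{x},\overline{y})$ with constant $M>0$ and $F(\overline{x})=\{\overline{y}\}$, then there exists $\varepsilon>0$ such that, for every $\rho\in(0,\varepsilon)$ and every $(x,z)\in\operatorname{Gr}\Phi\cap[B(\overline{x},\varepsilon)\times B(\overline{z},\varepsilon)]$, one has $B(z,(C-MD)\rho)\subset\Phi(B(x,\rho))$.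
   Context: A multifunction $F:X\rightrightarrows Y$ assigns to each $x$ a (possibly empty) subset $F(x)\subset Y$; $\operatorname{Gr}F=\{(x,y)\mid y\in F(x)\}$; $F(A):=\bigcup_{x\in A}F(x)$. $B(x,r)$ is the open ball with center $x$ and radius $r$; $\mathbb{D}_Y$ is the closed unit ball of $Y$. Product spaces carry the sum norm. A set is locally closed around a point if its intersection with some closed neighborhood of that point is closed. $F$ is open at linear rate $L>0$ around $(\overline{x},\overline{y})\in\operatorname{Gr}F$ if there exist $\varepsilon>0$ and neighborhoods $U$ of $\overline{x}$, $V$ of $\overline{y}$ such that, for every $\rho\in(0,\varepsilon)$ and every $(x,y)\in\operatorname{Gr}F\cap[U\times V]$, $B(y,\rho L)\subset F(B(x,\rho))$. $F$ is Lipschitz-like around $(\overline{x},\overline{y})$ with constant $M$ if there exist neighborhoods $U$ of $\overline{x}$, $V$ of $\overline{y}$ such that, for every $x,u\in U$, $F(x)\cap V\subset F(u)+M\|x-u\|\mathbb{D}_Y$. $F$ is Lipschitz around $(\overline{x},\overline{y})$ with constant $M$ if there is a neighborhood $U$ of $\overline{x}$ such that, for every $x,u\in U$, $F(x)\subset F(u)+M\|x-u\|\mathbb{D}_Y$. $G:X\times Y\rightrightarrows Z$ is open at linear rate with respect to $y$ uniformly in $x$ around $((\overline{x},\overline{y}),\overline{z})\in\operatorname{Gr}G$ with constant $C>0$ if there exist $\varepsilon>0$ and neighborhoods $U$ of $\overline{x}$, $V$ of $\overline{y}$, $N$ of $\overline{z}$ such that, for every $\rho\in(0,\varepsilon)$,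 every $x\in U$ and every $(y,z)\in V\times N$ with $z\in G(x,y)$, $B(z,\rho C)\subset G(\{x\}\times B(y,\rho))$. $G$ is Lipschitz-like with respect to $x$ uniformly in $y$ around $((\overline{x},\overline{y}),\overline{z})$ with constant $D\ge0$ if there exist neighborhoods $U$ of $\overline{x}$, $V$ of $\overline{y}$, $N$ of $\overline{z}$ such that, for every $x,u\in U$ and every $y\in V$, $G(x,y)\cap N\subset G(u,y)+D\|x-u\|\mathbb{D}_Z$. The notions "open at linear rate with respect to $x$ uniformly in $y$" and "Lipschitz-like with respect to $y$ uniformly in $x$" are obtained by exchanging the roles of $x$ and $y$. *)

theory Defs
  imports "HOL-Analysis.Analysis" "HOL-Library.Set_Algebras"
begin

text \<open>
  A multifunction from \<open>X\<close> to \<open>Y\<close> is a function \<open>F :: 'x \<Rightarrow> 'y set\<close> whose values may be empty.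
  A neighborhood of a point \<open>a\<close> is any set having \<open>a\<close> in its interior.
\<close>

definition mf_graph :: "('x \<Rightarrow> 'y set) \<Rightarrow> ('x \<times> 'y) set" where
  "mf_graph F = {(x, y). y \<in> F x}"

definition mf_image :: "('x \<Rightarrow> 'y set) \<Rightarrow> 'x set \<Rightarrow> 'y set" where
  "mf_image F A = (\<Union>x\<in>A. F x)"

definition mf_compose :: "('x \<Rightarrow> 'y set) \<Rightarrow> ('x \<times> 'y \<Rightarrow> 'z set) \<Rightarrow> 'x \<Rightarrow> 'z set" where
  "mf_compose F G x = (\<Union>y\<in>F x. G (x, y))"

text \<open>
  On products the library norm is the Euclidean combination of the norms of the factors, not their
  sum. Both induce the product topology, and only that topology enters the next notion.
\<close>

definition locally_closed_around :: "'a::topological_space set \<Rightarrow> 'a \<Rightarrow> bool" where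
  "locally_closed_around S a \<longleftrightarrow> (\<exists>K. closed K \<and> a \<in> interior K \<and> closed (S \<inter> K))"

text \<open>\<open>scaled_unit_ball r\<close> is \<open>r\<close> times the closed unit ball; it is \<open>{0}\<close> for \<open>r = 0\<close>.\<close>

definition scaled_unit_ball :: "real \<Rightarrow> 'y::real_normed_vector set" where
  "scaled_unit_ball r = (\<lambda>v. r *\<^sub>R v) ` cball 0 1"

definition open_at_linear_rate ::
  "('x::real_normed_vector \<Rightarrow> 'y::real_normed_vector set) \<Rightarrow> 'x \<Rightarrow> 'y \<Rightarrow> real \<Rightarrow> bool" where
  "open_at_linear_rate F xb yb L \<longleftrightarrow>
    (\<exists>\<epsilon>>0. \<exists>U V. xb \<in> interior U \<and> yb \<in> interior V \<and>
      (\<forall>\<rho>\<in>{0<..<\<epsilon>}. \<forall>(x, y) \<in> mf_graph F \<inter> U \<times> V.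
        ball y (\<rho> * L) \<subseteq> mf_image F (ball x \<rho>)))"

definition lipschitz_like ::
  "('x::real_normed_vector \<Rightarrow> 'y::real_normed_vector set) \<Rightarrow> 'x \<Rightarrow> 'y \<Rightarrow> real \<Rightarrow> bool" where
  "lipschitz_like F xb yb M \<longleftrightarrow>
    (\<exists>U V. xb \<in> interior U \<and> yb \<in> interior V \<and>
      (\<forall>x\<in>U. \<forall>u\<in>U. F x \<inter> V \<subseteq> F u + scaled_unit_ball (M * norm (x - u))))"

text \<open>Lipschitz behaviour of \<open>F\<close> around \<open>(xb, yb)\<close> does not constrain \<open>yb\<close>.\<close>

definition lipschitz_around ::
  "('x::real_normed_vector \<Rightarrow> 'y::real_normed_vector set) \<Rightarrow> 'x \<Rightarrow> 'y \<Rightarrow> real \<Rightarrow> bool" where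
  "lipschitz_around F xb yb M \<longleftrightarrow>
    (\<exists>U. xb \<in> interior U \<and>
      (\<forall>x\<in>U. \<forall>u\<in>U. F x \<subseteq> F u + scaled_unit_ball (M * norm (x - u))))"

text \<open>
  Partial notions for \<open>G\<close> on a product: the suffix names the variable with respect to which the
  property holds; it is uniform in the other one.
\<close>

definition open_at_linear_rate_snd ::
  "('x::real_normed_vector \<times> 'y::real_normed_vector \<Rightarrow> 'z::real_normed_vector set)
    \<Rightarrow> 'x \<Rightarrow> 'y \<Rightarrow> 'z \<Rightarrow> real \<Rightarrow> bool" where
  "open_at_linear_rate_snd G xb yb zb C \<longleftrightarrow>
    (\<exists>\<epsilon>>0. \<exists>U V N. xb \<in> interior U \<and> yb \<in> interior V \<and> zb \<in> interior N \<and>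
      (\<forall>\<rho>\<in>{0<..<\<epsilon>}. \<forall>x\<in>U. \<forall>(y, z) \<in> V \<times> N. z \<in> G (x, y) \<longrightarrow>
        ball z (\<rho> * C) \<subseteq> mf_image G ({x} \<times> ball y \<rho>)))"

definition open_at_linear_rate_fst ::
  "('x::real_normed_vector \<times> 'y::real_normed_vector \<Rightarrow> 'z::real_normed_vector set)
    \<Rightarrow> 'x \<Rightarrow> 'y \<Rightarrow> 'z \<Rightarrow> real \<Rightarrow> bool" where
  "open_at_linear_rate_fst G xb yb zb C \<longleftrightarrow>
    (\<exists>\<epsilon>>0. \<exists>U V N. xb \<in> interior U \<and> yb \<in> interior V \<and> zb \<in> interior N \<and>
      (\<forall>\<rho>\<in>{0<..<\<epsilon>}. \<forall>y\<in>V. \<forall>(x, z) \<in> U \<times> N. z \<in> G (x, y) \<longrightarrow>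
        ball z (\<rho> * C) \<subseteq> mf_image G (ball x \<rho> \<times> {y})))"

definition lipschitz_like_fst ::
  "('x::real_normed_vector \<times> 'y::real_normed_vector \<Rightarrow> 'z::real_normed_vector set)
    \<Rightarrow> 'x \<Rightarrow> 'y \<Rightarrow> 'z \<Rightarrow> real \<Rightarrow> bool" where
  "lipschitz_like_fst G xb yb zb D \<longleftrightarrow>
    (\<exists>U V N. xb \<in> interior U \<and> yb \<in> interior V \<and> zb \<in> interior N \<and>
      (\<forall>x\<in>U. \<forall>u\<in>U. \<forall>y\<in>V.
        G (x, y) \<inter> N \<subseteq> G (u, y) + scaled_unit_ball (D * norm (x - u))))"

definition lipschitz_like_snd ::
  "('x::real_normed_vector \<times> 'y::real_normed_vector \<Rightarrow> 'z::real_normed_vector set)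
    \<Rightarrow> 'x \<Rightarrow> 'y \<Rightarrow> 'z \<Rightarrow> real \<Rightarrow> bool" where
  "lipschitz_like_snd G xb yb zb D \<longleftrightarrow>
    (\<exists>U V N. xb \<in> interior U \<and> yb \<in> interior V \<and> zb \<in> interior N \<and>
      (\<forall>y\<in>V. \<forall>v\<in>V. \<forall>x\<in>U.
        G (x, y) \<inter> N \<subseteq> G (x, v) + scaled_unit_ball (D * norm (y - v))))"

end

theory Submission
  imports Defs
begin

text \<open>
  Both parts are instances of one iteration scheme, in the style of Lyusternik and Graves. Let \<open>T\<close> be
  the set of triples \<open>(x, y, z)\<close> with \<open>y \<in> F x\<close> and \<open>z \<in> G (x, y)\<close>, and let \<open>w\<close> be a target at
  distance less than \<open>d\<close> from \<open>z\<close>. One correction step replaces the triple by another one in \<open>T\<close>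
  whose first component has moved by at most \<open>d / a\<close>, whose second has moved by \<open>O(d)\<close>, and
  whose third is within \<open>(b / a) * d\<close> of \<open>w\<close>.

  In (A), openness of \<open>G (x, \<cdot>)\<close> yields \<open>y'\<close> with \<open>w \<in> G (x, y')\<close>, openness of \<open>F\<close> yields \<open>x'\<close> with
  \<open>y' \<in> F x'\<close>, and the Lipschitz property in \<open>x\<close> bounds the new error; here \<open>a = L * C\<close> and
  \<open>b = D\<close>. In (B), openness of \<open>G (\<cdot>, y)\<close> yields \<open>x'\<close> with \<open>w \<in> G (x', y)\<close>, the Lipschitz property
  of \<open>F\<close> yields \<open>y' \<in> F x'\<close>, and that of \<open>G\<close> in \<open>y\<close> bounds the new error; here \<open>a = C\<close> and
  \<open>b = M * D\<close>. As \<open>b < a\<close>, the steps decay geometrically: with ratio \<open>b / a\<close> the displacements of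
  \<open>x\<close> would add up to \<open>d / (a - b)\<close>. The limit has third component \<open>w\<close> and lies in \<open>T\<close> because \<open>T\<close>
  is locally closed. The exact rate \<open>a - b\<close> survives since the balls are open:
  a target in the open ball leaves room for a slightly worse ratio than \<open>b / a\<close>.
  This argument is \<open>openness_of_contracting_correction\<close>.

  The two statements about the graph of the composition only require that a witness \<open>y\<close> is automatically
  close to \<open>yb\<close>. In (A) a witness close to \<open>yb\<close> exists by \<open>nearby_witness\<close>, and disjointness of the
  values of \<open>G (x, \<cdot>)\<close> makes it the only one; in (B) every value of \<open>F x\<close> is close to the single
  value of \<open>F xb\<close>.
\<close>

section \<open>Geometric iteration in complete metric spaces\<close>

lemma Cauchy_of_geometric_steps:
  fixes s :: "nat \<Rightarrow> 'a::metric_space"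
  assumes \<theta>: "0 < \<theta>" "\<theta> < 1" and step: "\<And>n. dist (s n) (s (Suc n)) \<le> c * \<theta> ^ n"
  shows "Cauchy s"
proof -
  have "0 \<le> c"
    using order_trans[OF zero_le_dist step[of 0]] by simp
  have bound: "dist (s m) (s (m + k)) \<le> c / (1 - \<theta>) * (\<theta> ^ m - \<theta> ^ (m + k))" for m k
  proof (induction k)
    case (Suc k)
    have "dist (s m) (s (m + Suc k)) \<le> dist (s m) (s (m + k)) + dist (s (m + k)) (s (Suc (m + k)))"
      by (simp add: dist_triangle)
    also have "\<dots> \<le> c / (1 - \<theta>) * (\<theta> ^ m - \<theta> ^ (m + k)) + c * \<theta> ^ (m + k)"
      using Suc step by (intro add_mono) auto
    also have "\<dots> = c / (1 - \<theta>) * (\<theta> ^ m - \<theta> ^ (m + Suc k))"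
      using \<theta> by (simp add: field_simps)
    finally show ?case .
  qed simp
  have tail: "dist (s m) (s (m + k)) \<le> c / (1 - \<theta>) * \<theta> ^ m" for m k
  proof -
    have "c / (1 - \<theta>) * (\<theta> ^ m - \<theta> ^ (m + k)) \<le> c / (1 - \<theta>) * \<theta> ^ m"
      using \<theta> \<open>0 \<le> c\<close> by (intro mult_left_mono) auto
    then show ?thesis using bound[of m k] by linarith
  qed
  have "(\<lambda>m. c / (1 - \<theta>) * \<theta> ^ m) \<longlonglongrightarrow> 0"
    using \<theta> by (intro tendsto_mult_right_zero LIMSEQ_power_zero) auto
  then have small: "\<exists>N. c / (1 - \<theta>) * \<theta> ^ N < e" if "0 < e" for e
    using that by (metis (no_types, lifting) eventually_sequentially order_refl order_tendstoD(2))
  show ?thesis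
    unfolding Cauchy_altdef2
  proof (intro allI impI)
    fix e :: real assume "0 < e"
    then obtain N where "c / (1 - \<theta>) * \<theta> ^ N < e"
      using small by blast
    then have "dist (s n) (s N) < e" if "n \<ge> N" for n
      using tail[of N "n - N"] that by (simp add: dist_commute)
    then show "\<exists>N. \<forall>n\<ge>N. dist (s n) (s N) < e" by blast
  qed
qed

text \<open>
  The common core of both parts. The hypothesis \<open>step\<close> is one correction of the error; since its bound
  \<open>b / a * d\<close> is not strict, any ratio \<open>\<theta>\<close> strictly between \<open>b / a\<close> and \<open>1\<close> restores the strict
  inequality that the next correction requires.
\<close>

lemma openness_of_contracting_correction:
  fixes T :: "('x::complete_space \<times> 'y::complete_space \<times> 'z::metric_space) set"
    and xb :: 'x and yb :: 'y and zb :: 'z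
  defines "W \<equiv> \<lambda>r. ball xb r \<times> ball yb r \<times> ball zb r"
  assumes ab: "0 \<le> b" "b < a" and K: "0 \<le> K" and r: "0 < r"
    and closed: "\<And>s l. (\<And>n. s n \<in> T \<inter> W r) \<Longrightarrow> s \<longlonglongrightarrow> l \<Longrightarrow> l \<in> T"
    and step: "\<And>x y z w d. (x, y, z) \<in> T \<inter> W r \<Longrightarrow> w \<in> ball zb r \<Longrightarrow> 0 < d \<Longrightarrow> d < r \<Longrightarrow>
      dist z w < d \<Longrightarrow>
      \<exists>x' y' z'. (x', y', z') \<in> T \<and> dist x x' \<le> d / a \<and> dist y y' \<le> K * d \<and> dist z' w \<le> b / a * d"
  shows "\<exists>\<epsilon>>0. \<forall>\<rho>\<in>{0<..<\<epsilon>}. \<forall>(x, y, z) \<in> T \<inter> W \<epsilon>.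
    \<forall>w\<in>ball z ((a - b) * \<rho>). \<exists>x'\<in>ball x \<rho>. \<exists>y'. (x', y', w) \<in> T"
proof -
  have a: "0 < a" using ab by linarith
  \<comment> \<open>The iterates stay within \<open>\<rho>\<close>, \<open>K * a * \<rho>\<close> and \<open>2 * a * \<rho>\<close> of the three initial components.\<close>
  define \<epsilon> where "\<epsilon> = r / (2 + K * a + 2 * a)"
  have den: "0 < 2 + K * a + 2 * a" using a K by (simp add: add_pos_nonneg)
  have \<epsilon>: "0 < \<epsilon>" using r den by (simp add: \<epsilon>_def)
  have "r = \<epsilon> * (2 + K * a + 2 * a)" using den by (simp add: \<epsilon>_def)
  then have r_eq: "r = 2 * \<epsilon> + K * a * \<epsilon> + 2 * (a * \<epsilon>)" by (simp add: algebra_simps)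
  have Ka\<epsilon>: "0 \<le> K * a * \<epsilon>" and a\<epsilon>: "0 < a * \<epsilon>" using a K \<epsilon> by auto
  have main: "\<exists>x'\<in>ball x0 \<rho>. \<exists>y'. (x', y', w) \<in> T"
    if \<rho>: "0 < \<rho>" "\<rho> < \<epsilon>" and start: "(x0, y0, z0) \<in> T \<inter> W \<epsilon>"
      and w: "w \<in> ball z0 ((a - b) * \<rho>)" for \<rho> x0 y0 z0 w
  proof -
    \<comment> \<open>Spend the slack of the open ball: first on a smaller radius, then on a larger ratio.\<close>
    have "dist z0 w / (a - b) < \<rho>" using w ab by (simp add: field_simps)
    then obtain \<rho>' where \<rho>': "dist z0 w / (a - b) < \<rho>'" "\<rho>' < \<rho>"
      using dense by blast
    have \<rho>'0: "0 < \<rho>'"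
    proof -
      have "0 \<le> dist z0 w / (a - b)" using ab by simp
      then show ?thesis using \<rho>'(1) by linarith
    qed
    have "dist z0 w < (a - b) * \<rho>'" using \<rho>'(1) ab by (simp add: field_simps)
    then have "b / a < 1 - dist z0 w / (a * \<rho>')" using a \<rho>'0 by (simp add: field_simps)
    then obtain \<theta> where \<theta>: "b / a < \<theta>" "\<theta> < 1 - dist z0 w / (a * \<rho>')"
      using dense by blast
    have "0 \<le> b / a" using ab a by simp
    then have \<theta>0: "0 < \<theta>" using \<theta>(1) by linarith
    have "0 \<le> dist z0 w / (a * \<rho>')" using a \<rho>'0 by simp
    then have \<theta>1: "\<theta> < 1" using \<theta>(2) by linarith
    define d where "d = a * \<rho>' * (1 - \<theta>)"
    have d0: "0 < d" using a \<rho>'0 \<theta>1 by (simp add: d_def)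
    have start_d: "dist z0 w < d"
      using \<theta>(2) a \<rho>'0 by (simp add: d_def field_simps)
    have a\<rho>': "a * \<rho>' < a * \<epsilon>" using a \<rho>'(2) \<rho>(2) by simp
    have d_le: "d < a * \<epsilon>"
    proof -
      have "d \<le> a * \<rho>' * 1" unfolding d_def using a \<rho>'0 \<theta>0 by (intro mult_left_mono) auto
      then show ?thesis using a\<rho>' by simp
    qed
    have dist_start: "dist xb x0 < \<epsilon>" "dist yb y0 < \<epsilon>" "dist zb z0 < \<epsilon>"
      using start by (auto simp: W_def)
    have w_r: "w \<in> ball zb r"
      using dist_triangle[of zb w z0] dist_start start_d d_le r_eq Ka\<epsilon> \<epsilon> a\<epsilon> by simp
    define P where "P = (\<lambda>n (x, y, z). (x, y, z) \<in> T \<and> dist z w < d * \<theta> ^ n \<and>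
      dist x0 x \<le> \<rho>' * (1 - \<theta> ^ n) \<and> dist y0 y \<le> K * a * \<rho>' * (1 - \<theta> ^ n))"
    define Q where "Q = (\<lambda>n (x :: 'x, y :: 'y, z :: 'z) (x', y', z' :: 'z).
      dist x x' \<le> d / a * \<theta> ^ n \<and> dist y y' \<le> K * d * \<theta> ^ n)"
    have pw: "0 \<le> \<theta> ^ n" "\<theta> ^ n \<le> 1" "0 < \<theta> ^ n" for n
      using \<theta>0 \<theta>1 by (auto intro: power_le_one)
    have in_W: "(x, y, z) \<in> T \<inter> W r" if "P n (x, y, z)" for n x y z
    proof -
      have "\<rho>' * (1 - \<theta> ^ n) \<le> \<rho>'" "K * a * \<rho>' * (1 - \<theta> ^ n) \<le> K * a * \<rho>'" "d * \<theta> ^ n \<le> d"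
        using pw[of n] \<rho>'0 K a d0 by (auto intro!: mult_left_le)
      moreover have "K * a * \<rho>' \<le> K * a * \<epsilon>"
        using K a \<rho>'(2) \<rho>(2) by (intro mult_left_mono) auto
      ultimately have "dist x0 x < \<epsilon>" "dist y0 y \<le> K * a * \<epsilon>" "dist z w < d"
        using that \<rho>'(2) \<rho>(2) by (auto simp: P_def)
      then show ?thesis
        using that dist_triangle[of xb x x0] dist_triangle[of yb y y0] dist_triangle[of zb z z0]
          dist_triangle2[of z0 z w] dist_start start_d d_le r_eq Ka\<epsilon> \<epsilon> a\<epsilon>
        by (simp add: P_def W_def)
    qed
    have next_iterate: "\<exists>p'. P (Suc n) p' \<and> Q n p p'" if Pp: "P n p" for p n
    proof -
      obtain x y z where p: "p = (x, y, z)" by (cases p)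
      have P: "(x, y, z) \<in> T" "dist z w < d * \<theta> ^ n" "dist x0 x \<le> \<rho>' * (1 - \<theta> ^ n)"
        "dist y0 y \<le> K * a * \<rho>' * (1 - \<theta> ^ n)"
        using Pp by (auto simp: P_def p)
      have dn: "0 < d * \<theta> ^ n" using d0 pw by simp
      have "d * \<theta> ^ n \<le> d" using pw[of n] d0 by (auto intro!: mult_left_le)
      then have "d * \<theta> ^ n < r" using d_le r_eq Ka\<epsilon> \<epsilon> a\<epsilon> by linarith
      then obtain x' y' z' where new: "(x', y', z') \<in> T" "dist x x' \<le> d * \<theta> ^ n / a"
        "dist y y' \<le> K * (d * \<theta> ^ n)" "dist z' w \<le> b / a * (d * \<theta> ^ n)"
        using step[OF in_W[OF Pp[unfolded p]] w_r dn _ P(2)] by blast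
      have "b / a * (d * \<theta> ^ n) < \<theta> * (d * \<theta> ^ n)"
        using \<theta>(1) dn by (intro mult_strict_right_mono)
      then have z': "dist z' w < d * \<theta> ^ Suc n" using new(4) by (simp add: mult_ac)
      have "d * \<theta> ^ n / a = \<rho>' * (1 - \<theta> ^ Suc n) - \<rho>' * (1 - \<theta> ^ n)"
        using a by (simp add: d_def field_simps)
      then have x': "dist x0 x' \<le> \<rho>' * (1 - \<theta> ^ Suc n)"
        using dist_triangle[of x0 x' x] P(3) new(2) by linarith
      have "K * (d * \<theta> ^ n) = K * a * \<rho>' * (1 - \<theta> ^ Suc n) - K * a * \<rho>' * (1 - \<theta> ^ n)"
        by (simp add: d_def algebra_simps)
      then have y': "dist y0 y' \<le> K * a * \<rho>' * (1 - \<theta> ^ Suc n)"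
        using dist_triangle[of y0 y' y] P(4) new(3) by linarith
      have "P (Suc n) (x', y', z') \<and> Q n p (x', y', z')"
        using new x' y' z' by (simp add: P_def Q_def p mult_ac)
      then show ?thesis by blast
    qed
    have "P 0 (x0, y0, z0)" using start start_d by (simp add: P_def)
    then obtain f where f: "\<And>n. P n (f n)" "\<And>n. Q n (f n) (f (Suc n))"
      using dependent_nat_choice[of P Q] next_iterate by metis
    define u where "u n = fst (f n)" for n
    define v where "v n = fst (snd (f n))" for n
    define t where "t n = snd (snd (f n))" for n
    have f_eq: "f n = (u n, v n, t n)" for n by (simp add: u_def v_def t_def)
    have "Cauchy u"
      using f(2) by (intro Cauchy_of_geometric_steps[OF \<theta>0 \<theta>1, of _ "d / a"]) (simp add: f_eq Q_def)
    then obtain x where x: "u \<longlonglongrightarrow> x" using Cauchy_convergent convergent_def by blast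
    have "Cauchy v"
      using f(2) by (intro Cauchy_of_geometric_steps[OF \<theta>0 \<theta>1, of _ "K * d"]) (simp add: f_eq Q_def)
    then obtain y where y: "v \<longlonglongrightarrow> y" using Cauchy_convergent convergent_def by blast
    have t: "t \<longlonglongrightarrow> w"
    proof (rule metric_tendsto_imp_tendsto)
      show "(\<lambda>n. d * \<theta> ^ n) \<longlonglongrightarrow> 0"
        using \<theta>0 \<theta>1 by (intro tendsto_mult_right_zero LIMSEQ_power_zero) auto
      show "\<forall>\<^sub>F n in sequentially. dist (t n) w \<le> dist (d * \<theta> ^ n) 0"
      proof (rule always_eventually, rule allI)
        fix n show "dist (t n) w \<le> dist (d * \<theta> ^ n) 0"
          using f(1)[of n] d0 pw[of n] by (simp add: f_eq P_def)
      qed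
    qed
    have "(\<lambda>n. (u n, v n, t n)) \<longlonglongrightarrow> (x, y, w)" using x y t by (intro tendsto_Pair)
    then have "(x, y, w) \<in> T"
      using closed[of "\<lambda>n. (u n, v n, t n)"] in_W f(1) f_eq by metis
    moreover have "dist x0 x \<le> \<rho>'"
    proof (rule Lim_bounded)
      show "(\<lambda>n. dist x0 (u n)) \<longlonglongrightarrow> dist x0 x" using x by (intro tendsto_intros)
      show "\<forall>n\<ge>0. dist x0 (u n) \<le> \<rho>'"
      proof (intro allI impI)
        fix n
        have "\<rho>' * (1 - \<theta> ^ n) \<le> \<rho>'" using pw[of n] \<rho>'0 by (auto intro!: mult_left_le)
        then show "dist x0 (u n) \<le> \<rho>'" using f(1)[of n] by (simp add: f_eq P_def)
      qed
    qed
    ultimately show ?thesis using \<rho>'(2) by force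
  qed
  show ?thesis
  proof (intro exI[of _ \<epsilon>] conjI ballI)
    fix \<rho> p assume "\<rho> \<in> {0<..<\<epsilon>}" "p \<in> T \<inter> W \<epsilon>"
    then show "case p of (x, y, z) \<Rightarrow>
        \<forall>w\<in>ball z ((a - b) * \<rho>). \<exists>x'\<in>ball x \<rho>. \<exists>y'. (x', y', w) \<in> T"
      using main by (cases p) auto
  qed (fact \<epsilon>)
qed

section \<open>The hypotheses in terms of balls of a common radius\<close>

lemma mem_plus_scaled_unit_ballD:
  fixes v :: "'a::real_normed_vector"
  assumes "v \<in> A + scaled_unit_ball r" and "0 \<le> r"
  shows "\<exists>a\<in>A. dist a v \<le> r"
proof -
  obtain a e where "a \<in> A" "e \<in> cball 0 1" "v = a + r *\<^sub>R e"
    using assms(1) by (auto simp: scaled_unit_ball_def elim!: set_plus_elim)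
  moreover have "norm (r *\<^sub>R e) \<le> r"
    using \<open>e \<in> cball 0 1\<close> \<open>0 \<le> r\<close> by (auto intro: mult_left_le)
  ultimately show ?thesis by (intro bexI[of _ a]) (simp_all add: dist_norm norm_minus_commute)
qed

lemma ball_subset_of_interior:
  fixes a :: "'a::metric_space"
  assumes "a \<in> interior U"
  shows "\<exists>R>0. ball a R \<subseteq> U"
  using assms by (meson mem_interior)

text \<open>
  Membership is kept as a hypothesis on the whole sequence because the iteration provides sequences
  that remain in a fixed ball, not sets that are closed.
\<close>

lemma locally_closed_aroundD:
  fixes a :: "'a::metric_space"
  assumes "locally_closed_around S a"
  shows "\<exists>R>0. \<forall>s l. (\<forall>n. s n \<in> S \<inter> ball a R) \<longrightarrow> s \<longlonglongrightarrow> l \<longrightarrow> l \<in> S"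
proof -
  obtain B where B: "a \<in> interior B" "closed (S \<inter> B)"
    using assms by (auto simp: locally_closed_around_def)
  then obtain R where R: "R > 0" "ball a R \<subseteq> B"
    using ball_subset_of_interior by blast
  have "l \<in> S" if "\<forall>n. s n \<in> S \<inter> ball a R" "s \<longlonglongrightarrow> l" for s l
    using closed_sequentially[OF B(2), of s l] that R(2) by blast
  with R(1) show ?thesis by blast
qed

lemma open_at_linear_rateD:
  assumes "open_at_linear_rate F xb yb L"
  shows "\<exists>R>0. \<forall>\<rho> x y v. 0 < \<rho> \<longrightarrow> \<rho> < R \<longrightarrow> x \<in> ball xb R \<longrightarrow> y \<in> ball yb R \<longrightarrow> y \<in> F x \<longrightarrow>
    dist y v < \<rho> * L \<longrightarrow> (\<exists>x'. dist x x' < \<rho> \<and> v \<in> F x')"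
proof -
  obtain \<epsilon> U V where "\<epsilon> > 0" and nb: "xb \<in> interior U" "yb \<in> interior V"
    and op: "\<And>\<rho> x y. \<rho> \<in> {0<..<\<epsilon>} \<Longrightarrow> (x, y) \<in> mf_graph F \<inter> U \<times> V \<Longrightarrow>
      ball y (\<rho> * L) \<subseteq> mf_image F (ball x \<rho>)"
    using assms unfolding open_at_linear_rate_def by blast
  obtain r1 r2 where r: "r1 > 0" "ball xb r1 \<subseteq> U" "r2 > 0" "ball yb r2 \<subseteq> V"
    using nb[THEN ball_subset_of_interior] by blast
  show ?thesis
  proof (intro exI[of _ "min \<epsilon> (min r1 r2)"] conjI allI impI)
    fix \<rho> x y v
    assume *: "0 < \<rho>" "\<rho> < min \<epsilon> (min r1 r2)" "x \<in> ball xb (min \<epsilon> (min r1 r2))"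
      "y \<in> ball yb (min \<epsilon> (min r1 r2))" "y \<in> F x" "dist y v < \<rho> * L"
    then have "(x, y) \<in> mf_graph F \<inter> U \<times> V" using r by (auto simp: mf_graph_def)
    then have "v \<in> mf_image F (ball x \<rho>)" using op[of \<rho> x y] * by auto
    then show "\<exists>x'. dist x x' < \<rho> \<and> v \<in> F x'" by (auto simp: mf_image_def)
  qed (use r \<open>\<epsilon> > 0\<close> in auto)
qed

lemma open_at_linear_rate_sndD:
  assumes "open_at_linear_rate_snd G xb yb zb C"
  shows "\<exists>R>0. \<forall>\<rho> x y z w. 0 < \<rho> \<longrightarrow> \<rho> < R \<longrightarrow> x \<in> ball xb R \<longrightarrow> y \<in> ball yb R \<longrightarrow> z \<in> ball zb R \<longrightarrow>
    z \<in> G (x, y) \<longrightarrow> dist z w < \<rho> * C \<longrightarrow> (\<exists>y'. dist y y' < \<rho> \<and> w \<in> G (x, y'))"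
proof -
  obtain \<epsilon> U V N where "\<epsilon> > 0"
    and nb: "xb \<in> interior U" "yb \<in> interior V" "zb \<in> interior N"
    and op: "\<And>\<rho> x y z. \<rho> \<in> {0<..<\<epsilon>} \<Longrightarrow> x \<in> U \<Longrightarrow> (y, z) \<in> V \<times> N \<Longrightarrow> z \<in> G (x, y) \<Longrightarrow>
      ball z (\<rho> * C) \<subseteq> mf_image G ({x} \<times> ball y \<rho>)"
    using assms unfolding open_at_linear_rate_snd_def by blast
  obtain r1 r2 r3 where r: "r1 > 0" "ball xb r1 \<subseteq> U" "r2 > 0" "ball yb r2 \<subseteq> V"
    "r3 > 0" "ball zb r3 \<subseteq> N"
    using nb[THEN ball_subset_of_interior] by blast
  show ?thesis
  proof (intro exI[of _ "min \<epsilon> (min r1 (min r2 r3))"] conjI allI impI)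
    fix \<rho> x y z w
    let ?R = "min \<epsilon> (min r1 (min r2 r3))"
    assume *: "0 < \<rho>" "\<rho> < ?R" "x \<in> ball xb ?R" "y \<in> ball yb ?R" "z \<in> ball zb ?R"
      "z \<in> G (x, y)" "dist z w < \<rho> * C"
    then have "x \<in> U" "(y, z) \<in> V \<times> N" using r by auto
    then have "w \<in> mf_image G ({x} \<times> ball y \<rho>)" using op[of \<rho> x y z] * by auto
    then show "\<exists>y'. dist y y' < \<rho> \<and> w \<in> G (x, y')" by (auto simp: mf_image_def)
  qed (use r \<open>\<epsilon> > 0\<close> in auto)
qed

lemma open_at_linear_rate_fstD:
  assumes "open_at_linear_rate_fst G xb yb zb C"
  shows "\<exists>R>0. \<forall>\<rho> x y z w. 0 < \<rho> \<longrightarrow> \<rho> < R \<longrightarrow> x \<in> ball xb R \<longrightarrow> y \<in> ball yb R \<longrightarrow> z \<in> ball zb R \<longrightarrow>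
    z \<in> G (x, y) \<longrightarrow> dist z w < \<rho> * C \<longrightarrow> (\<exists>x'. dist x x' < \<rho> \<and> w \<in> G (x', y))"
proof -
  obtain \<epsilon> U V N where "\<epsilon> > 0"
    and nb: "xb \<in> interior U" "yb \<in> interior V" "zb \<in> interior N"
    and op: "\<And>\<rho> y x z. \<rho> \<in> {0<..<\<epsilon>} \<Longrightarrow> y \<in> V \<Longrightarrow> (x, z) \<in> U \<times> N \<Longrightarrow> z \<in> G (x, y) \<Longrightarrow>
      ball z (\<rho> * C) \<subseteq> mf_image G (ball x \<rho> \<times> {y})"
    using assms unfolding open_at_linear_rate_fst_def by blast
  have swap: "mf_image G (ball x \<rho> \<times> {y}) = mf_image (G \<circ> prod.swap) ({y} \<times> ball x \<rho>)" for x y \<rho>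
    by (auto simp: mf_image_def)
  have "open_at_linear_rate_snd (G \<circ> prod.swap) yb xb zb C"
    unfolding open_at_linear_rate_snd_def
  proof (intro exI[of _ \<epsilon>] exI[of _ V] exI[of _ U] exI[of _ N] conjI ballI nb \<open>\<epsilon> > 0\<close>)
    fix \<rho> y p assume "\<rho> \<in> {0<..<\<epsilon>}" "y \<in> V" "p \<in> U \<times> N"
    then show "case p of (x, z) \<Rightarrow> z \<in> (G \<circ> prod.swap) (y, x) \<longrightarrow>
        ball z (\<rho> * C) \<subseteq> mf_image (G \<circ> prod.swap) ({y} \<times> ball x \<rho>)"
      using op unfolding swap by (cases p) simp
  qed
  from open_at_linear_rate_sndD[OF this] obtain R where "R > 0"
    and R: "\<And>\<rho> y x z w. 0 < \<rho> \<Longrightarrow> \<rho> < R \<Longrightarrow> y \<in> ball yb R \<Longrightarrow> x \<in> ball xb R \<Longrightarrow> z \<in> ball zb R \<Longrightarrow>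
      z \<in> G (x, y) \<Longrightarrow> dist z w < \<rho> * C \<Longrightarrow> \<exists>x'. dist x x' < \<rho> \<and> w \<in> G (x', y)"
    by (simp del: mem_ball) blast
  then show ?thesis by blast
qed

lemma lipschitz_likeD:
  assumes "lipschitz_like F xb yb M" and "0 \<le> M"
  shows "\<exists>R>0. \<forall>x u y. x \<in> ball xb R \<longrightarrow> u \<in> ball xb R \<longrightarrow> y \<in> ball yb R \<longrightarrow> y \<in> F x \<longrightarrow>
    (\<exists>y'\<in>F u. dist y' y \<le> M * dist x u)"
proof -
  obtain U V where nb: "xb \<in> interior U" "yb \<in> interior V"
    and lip: "\<And>x u. x \<in> U \<Longrightarrow> u \<in> U \<Longrightarrow> F x \<inter> V \<subseteq> F u + scaled_unit_ball (M * norm (x - u))"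
    using assms(1) unfolding lipschitz_like_def by blast
  obtain r1 r2 where r: "r1 > 0" "ball xb r1 \<subseteq> U" "r2 > 0" "ball yb r2 \<subseteq> V"
    using nb[THEN ball_subset_of_interior] by blast
  show ?thesis
  proof (intro exI[of _ "min r1 r2"] conjI allI impI)
    fix x u y
    assume *: "x \<in> ball xb (min r1 r2)" "u \<in> ball xb (min r1 r2)" "y \<in> ball yb (min r1 r2)" "y \<in> F x"
    then have "x \<in> U" "u \<in> U" "y \<in> V" using r by auto
    then have "y \<in> F u + scaled_unit_ball (M * dist x u)"
      using lip[of x u] *(4) by (auto simp: dist_norm)
    then show "\<exists>y'\<in>F u. dist y' y \<le> M * dist x u"
      using \<open>0 \<le> M\<close> by (intro mem_plus_scaled_unit_ballD) auto
  qed (use r in auto)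
qed

lemma lipschitz_like_fstD:
  assumes "lipschitz_like_fst G xb yb zb D" and "0 \<le> D"
  shows "\<exists>R>0. \<forall>x u y z. x \<in> ball xb R \<longrightarrow> u \<in> ball xb R \<longrightarrow> y \<in> ball yb R \<longrightarrow> z \<in> ball zb R \<longrightarrow>
    z \<in> G (x, y) \<longrightarrow> (\<exists>z'\<in>G (u, y). dist z' z \<le> D * dist x u)"
proof -
  obtain U V N where nb: "xb \<in> interior U" "yb \<in> interior V" "zb \<in> interior N"
    and lip: "\<And>x u y. x \<in> U \<Longrightarrow> u \<in> U \<Longrightarrow> y \<in> V \<Longrightarrow>
      G (x, y) \<inter> N \<subseteq> G (u, y) + scaled_unit_ball (D * norm (x - u))"
    using assms(1) unfolding lipschitz_like_fst_def by blast
  obtain r1 r2 r3 where r: "r1 > 0" "ball xb r1 \<subseteq> U" "r2 > 0" "ball yb r2 \<subseteq> V"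
    "r3 > 0" "ball zb r3 \<subseteq> N"
    using nb[THEN ball_subset_of_interior] by blast
  show ?thesis
  proof (intro exI[of _ "min r1 (min r2 r3)"] conjI allI impI)
    fix x u y z
    let ?R = "min r1 (min r2 r3)"
    assume *: "x \<in> ball xb ?R" "u \<in> ball xb ?R" "y \<in> ball yb ?R" "z \<in> ball zb ?R" "z \<in> G (x, y)"
    then have "x \<in> U" "u \<in> U" "y \<in> V" "z \<in> N" using r by auto
    then have "z \<in> G (u, y) + scaled_unit_ball (D * dist x u)"
      using lip[of x u y] *(5) by (auto simp: dist_norm)
    then show "\<exists>z'\<in>G (u, y). dist z' z \<le> D * dist x u"
      using \<open>0 \<le> D\<close> by (intro mem_plus_scaled_unit_ballD) auto
  qed (use r in auto)
qed

lemma lipschitz_like_sndD: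
  assumes "lipschitz_like_snd G xb yb zb D" and "0 \<le> D"
  shows "\<exists>R>0. \<forall>x y v z. x \<in> ball xb R \<longrightarrow> y \<in> ball yb R \<longrightarrow> v \<in> ball yb R \<longrightarrow> z \<in> ball zb R \<longrightarrow>
    z \<in> G (x, y) \<longrightarrow> (\<exists>z'\<in>G (x, v). dist z' z \<le> D * dist y v)"
proof -
  have "lipschitz_like_fst (G \<circ> prod.swap) yb xb zb D"
    using assms(1) unfolding lipschitz_like_fst_def lipschitz_like_snd_def by simp blast
  from lipschitz_like_fstD[OF this \<open>0 \<le> D\<close>] show ?thesis by (auto 0 4)
qed

section \<open>Openness of the composition at nearby triples\<close>

definition composition_triples ::
  "('x \<Rightarrow> 'y set) \<Rightarrow> ('x \<times> 'y \<Rightarrow> 'z set) \<Rightarrow> ('x \<times> 'y \<times> 'z) set" where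
  "composition_triples F G = {(x, y, z). y \<in> F x \<and> z \<in> G (x, y)}"

lemma mem_composition_triples [simp]:
  "(x, y, z) \<in> composition_triples F G \<longleftrightarrow> y \<in> F x \<and> z \<in> G (x, y)"
  by (simp add: composition_triples_def)

lemma composition_triples_locally_closed:
  fixes xb :: "'x::metric_space" and yb :: "'y::metric_space" and zb :: "'z::metric_space"
  assumes "locally_closed_around (mf_graph F) (xb, yb)"
    and "locally_closed_around (mf_graph G) ((xb, yb), zb)"
  shows "\<exists>R>0. \<forall>s l. (\<forall>n. s n \<in> composition_triples F G \<inter> ball xb R \<times> ball yb R \<times> ball zb R) \<longrightarrow>
    s \<longlonglongrightarrow> l \<longrightarrow> l \<in> composition_triples F G"
proof -
  obtain R1 where "R1 > 0"
    and R1: "\<And>s l. (\<forall>n. s n \<in> mf_graph F \<inter> ball (xb, yb) R1) \<Longrightarrow> s \<longlonglongrightarrow> l \<Longrightarrow> l \<in> mf_graph F"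
    using locally_closed_aroundD[OF assms(1)] by blast
  obtain R2 where "R2 > 0"
    and R2: "\<And>s l. (\<forall>n. s n \<in> mf_graph G \<inter> ball ((xb, yb), zb) R2) \<Longrightarrow> s \<longlonglongrightarrow> l \<Longrightarrow> l \<in> mf_graph G"
    using locally_closed_aroundD[OF assms(2)] by blast
  define R where "R = min R1 R2 / 3"
  have R: "R > 0" "3 * R \<le> R1" "3 * R \<le> R2" using \<open>R1 > 0\<close> \<open>R2 > 0\<close> by (auto simp: R_def)
  have pair: "dist (a, b) (a', b') \<le> dist a a' + dist b b'"
    for a a' :: "'c::metric_space" and b b' :: "'d::metric_space"
    by (simp add: dist_Pair_Pair sqrt_sum_squares_le_sum)
  have "l \<in> composition_triples F G"
    if s: "\<forall>n. s n \<in> composition_triples F G \<inter> ball xb R \<times> ball yb R \<times> ball zb R"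
      and lim: "s \<longlonglongrightarrow> l" for s l
  proof -
    have near: "fst (s n) \<in> ball xb R" "fst (snd (s n)) \<in> ball yb R" "snd (snd (s n)) \<in> ball zb R"
      and mem: "fst (snd (s n)) \<in> F (fst (s n))"
        "snd (snd (s n)) \<in> G (fst (s n), fst (snd (s n)))" for n
      using s[rule_format, of n] by (auto simp: composition_triples_def)
    define p where "p n = (fst (s n), fst (snd (s n)))" for n
    define q where "q n = (p n, snd (snd (s n)))" for n
    have d1: "dist (xb, yb) (p n) < 2 * R" for n
      using near(1,2)[of n] pair[of xb yb "fst (s n)" "fst (snd (s n))"] by (simp add: p_def)
    have d2: "dist ((xb, yb), zb) (q n) < 3 * R" for n
      using near(3)[of n] d1[of n] pair[of "(xb, yb)" zb "p n" "snd (snd (s n))"] by (simp add: q_def)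
    have "(fst l, fst (snd l)) \<in> mf_graph F"
    proof (rule R1)
      show "\<forall>n. p n \<in> mf_graph F \<inter> ball (xb, yb) R1"
      proof
        fix n show "p n \<in> mf_graph F \<inter> ball (xb, yb) R1"
          using mem(1)[of n] d1[of n] R by (simp add: p_def mf_graph_def)
      qed
      show "p \<longlonglongrightarrow> (fst l, fst (snd l))" unfolding p_def using lim by (intro tendsto_intros)
    qed
    moreover have "((fst l, fst (snd l)), snd (snd l)) \<in> mf_graph G"
    proof (rule R2)
      show "\<forall>n. q n \<in> mf_graph G \<inter> ball ((xb, yb), zb) R2"
      proof
        fix n show "q n \<in> mf_graph G \<inter> ball ((xb, yb), zb) R2"
          using mem(2)[of n] d2[of n] R by (simp add: q_def p_def mf_graph_def)
      qed
      show "q \<longlonglongrightarrow> ((fst l, fst (snd l)), snd (snd l))"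
        unfolding q_def p_def using lim by (intro tendsto_intros)
    qed
    ultimately show ?thesis by (cases l) (simp add: mf_graph_def)
  qed
  with R(1) show ?thesis by blast
qed

text \<open>
  The correction step is the same for both parts up to the constants, so the passage from it to the
  openness of the composition is made once.
\<close>

lemma composition_open_of_correction:
  fixes F :: "'x::banach \<Rightarrow> 'y::banach set" and G :: "'x \<times> 'y \<Rightarrow> 'z::banach set"
    and xb :: 'x and yb :: 'y and zb :: 'z
  defines "T \<equiv> composition_triples F G"
  assumes closed: "locally_closed_around (mf_graph F) (xb, yb)"
      "locally_closed_around (mf_graph G) ((xb, yb), zb)"
    and ab: "0 \<le> b" "b < a" and K: "0 \<le> K" and r: "0 < r"
    and step: "\<And>x y z w d. (x, y, z) \<in> T \<Longrightarrow> x \<in> ball xb r \<Longrightarrow> y \<in> ball yb r \<Longrightarrow> z \<in> ball zb r \<Longrightarrow>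
      w \<in> ball zb r \<Longrightarrow> 0 < d \<Longrightarrow> d < r \<Longrightarrow> dist z w < d \<Longrightarrow>
      \<exists>x' y' z'. (x', y', z') \<in> T \<and> dist x x' \<le> d / a \<and> dist y y' \<le> K * d \<and> dist z' w \<le> b / a * d"
  shows "\<exists>\<epsilon>>0. \<forall>\<rho>\<in>{0<..<\<epsilon>}. \<forall>(x, y, z) \<in> ball xb \<epsilon> \<times> ball yb \<epsilon> \<times> ball zb \<epsilon>.
    y \<in> F x \<and> z \<in> G (x, y) \<longrightarrow> ball z ((a - b) * \<rho>) \<subseteq> mf_image (mf_compose F G) (ball x \<rho>)"
proof -
  obtain R where "R > 0" and R: "\<And>s l. (\<forall>n. s n \<in> T \<inter> ball xb R \<times> ball yb R \<times> ball zb R) \<Longrightarrow>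
      s \<longlonglongrightarrow> l \<Longrightarrow> l \<in> T"
    using composition_triples_locally_closed[OF closed] unfolding T_def by blast
  have "\<exists>\<epsilon>>0. \<forall>\<rho>\<in>{0<..<\<epsilon>}. \<forall>(x, y, z) \<in> T \<inter> ball xb \<epsilon> \<times> ball yb \<epsilon> \<times> ball zb \<epsilon>.
      \<forall>w\<in>ball z ((a - b) * \<rho>). \<exists>x'\<in>ball x \<rho>. \<exists>y'. (x', y', w) \<in> T"
  proof (rule openness_of_contracting_correction[OF ab K, where r = "min r R"])
    fix s :: "nat \<Rightarrow> 'x \<times> 'y \<times> 'z" and l
    assume s: "\<And>n. s n \<in> T \<inter> ball xb (min r R) \<times> ball yb (min r R) \<times> ball zb (min r R)"
    have "s n \<in> T \<inter> ball xb R \<times> ball yb R \<times> ball zb R" for n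
      using s[of n] by (cases "s n") auto
    then have "\<forall>n. s n \<in> T \<inter> ball xb R \<times> ball yb R \<times> ball zb R" ..
    moreover assume "s \<longlonglongrightarrow> l"
    ultimately show "l \<in> T" by (rule R)
  next
    fix x y z w d
    assume "(x, y, z) \<in> T \<inter> ball xb (min r R) \<times> ball yb (min r R) \<times> ball zb (min r R)"
      "w \<in> ball zb (min r R)" "0 < d" "d < min r R" "dist z w < d"
    then show "\<exists>x' y' z'. (x', y', z') \<in> T \<and> dist x x' \<le> d / a \<and> dist y y' \<le> K * d \<and>
        dist z' w \<le> b / a * d"
      by (intro step) auto
  qed (use r \<open>R > 0\<close> in auto)
  then obtain \<epsilon> where "\<epsilon> > 0" and \<epsilon>: "\<And>\<rho> x y z w. \<rho> \<in> {0<..<\<epsilon>} \<Longrightarrow> (x, y, z) \<in> T \<Longrightarrow>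
      (x, y, z) \<in> ball xb \<epsilon> \<times> ball yb \<epsilon> \<times> ball zb \<epsilon> \<Longrightarrow> w \<in> ball z ((a - b) * \<rho>) \<Longrightarrow>
      \<exists>x'\<in>ball x \<rho>. \<exists>y'. (x', y', w) \<in> T"
    by blast
  show ?thesis
  proof (intro exI[of _ \<epsilon>] conjI ballI)
    fix \<rho> p assume \<rho>: "\<rho> \<in> {0<..<\<epsilon>}" and p: "p \<in> ball xb \<epsilon> \<times> ball yb \<epsilon> \<times> ball zb \<epsilon>"
    obtain x y z where xyz: "p = (x, y, z)" by (cases p)
    have "w \<in> mf_image (mf_compose F G) (ball x \<rho>)"
      if "y \<in> F x" "z \<in> G (x, y)" "w \<in> ball z ((a - b) * \<rho>)" for w
      using \<epsilon>[OF \<rho> _ p[unfolded xyz] that(3)] that(1,2)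
      by (auto simp: T_def mf_image_def mf_compose_def)
    then show "case p of (x, y, z) \<Rightarrow> y \<in> F x \<and> z \<in> G (x, y) \<longrightarrow>
        ball z ((a - b) * \<rho>) \<subseteq> mf_image (mf_compose F G) (ball x \<rho>)"
      by (auto simp: xyz)
  qed (fact \<open>\<epsilon> > 0\<close>)
qed

text \<open>
  The error is removed first by moving \<open>y\<close> (openness of \<open>G\<close>), and \<open>x\<close> then follows (openness of \<open>F\<close>); moving \<open>x\<close> spoils
  the equation \<open>w \<in> G (x, y')\<close> by at most \<open>D\<close> times the displacement.
\<close>

lemma composition_open_of_open_inner:
  fixes F :: "'x::banach \<Rightarrow> 'y::banach set" and G :: "'x \<times> 'y \<Rightarrow> 'z::banach set"
    and xb :: 'x and yb :: 'y and zb :: 'z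
  assumes closed: "locally_closed_around (mf_graph F) (xb, yb)"
      "locally_closed_around (mf_graph G) ((xb, yb), zb)"
    and D: "0 \<le> D" "lipschitz_like_fst G xb yb zb D"
    and C: "0 < C" "open_at_linear_rate_snd G xb yb zb C"
    and L: "0 < L" "open_at_linear_rate F xb yb L"
    and lt: "D < L * C"
  shows "\<exists>\<epsilon>>0. \<forall>\<rho>\<in>{0<..<\<epsilon>}. \<forall>(x, y, z) \<in> ball xb \<epsilon> \<times> ball yb \<epsilon> \<times> ball zb \<epsilon>.
    y \<in> F x \<and> z \<in> G (x, y) \<longrightarrow> ball z ((L * C - D) * \<rho>) \<subseteq> mf_image (mf_compose F G) (ball x \<rho>)"
proof -
  obtain R1 where "R1 > 0" and R1: "\<And>x u y z. x \<in> ball xb R1 \<Longrightarrow> u \<in> ball xb R1 \<Longrightarrow>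
      y \<in> ball yb R1 \<Longrightarrow> z \<in> ball zb R1 \<Longrightarrow> z \<in> G (x, y) \<Longrightarrow> \<exists>z'\<in>G (u, y). dist z' z \<le> D * dist x u"
    using lipschitz_like_fstD[OF D(2,1)] by blast
  obtain R2 where "R2 > 0" and R2: "\<And>\<rho> x y z w. 0 < \<rho> \<Longrightarrow> \<rho> < R2 \<Longrightarrow> x \<in> ball xb R2 \<Longrightarrow>
      y \<in> ball yb R2 \<Longrightarrow> z \<in> ball zb R2 \<Longrightarrow> z \<in> G (x, y) \<Longrightarrow> dist z w < \<rho> * C \<Longrightarrow>
      \<exists>y'. dist y y' < \<rho> \<and> w \<in> G (x, y')"
    using open_at_linear_rate_sndD[OF C(2)] by blast
  obtain R3 where "R3 > 0" and R3: "\<And>\<rho> x y v. 0 < \<rho> \<Longrightarrow> \<rho> < R3 \<Longrightarrow> x \<in> ball xb R3 \<Longrightarrow>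
      y \<in> ball yb R3 \<Longrightarrow> y \<in> F x \<Longrightarrow> dist y v < \<rho> * L \<Longrightarrow> \<exists>x'. dist x x' < \<rho> \<and> v \<in> F x'"
    using open_at_linear_rateD[OF L(2)] by blast
  define R where "R = min R1 (min R2 R3)"
  have R: "0 < R" "R \<le> R1" "R \<le> R2" "R \<le> R3"
    using \<open>R1 > 0\<close> \<open>R2 > 0\<close> \<open>R3 > 0\<close> by (auto simp: R_def)
  \<comment> \<open>Room for one correction: \<open>r\<close> plus a displacement \<open>r / C\<close> of \<open>y\<close> or \<open>r / (L * C)\<close> of \<open>x\<close>.\<close>
  define r where "r = R / (1 + 1 / C + 1 / (L * C))"
  have den: "0 < 1 + 1 / C + 1 / (L * C)" using C L by (simp add: add_pos_pos)
  have r: "0 < r" using R den by (simp add: r_def)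
  have "R = r * (1 + 1 / C + 1 / (L * C))" using den by (simp add: r_def)
  then have R_eq: "R = r + r / C + r / (L * C)" by (simp add: algebra_simps)
  have parts: "0 < r / C" "0 < r / (L * C)" using r C L by auto
  show ?thesis
  proof (rule composition_open_of_correction[OF closed D(1) lt _ r, where K = "1 / C"])
    show "0 \<le> 1 / C" using C by simp
    fix x y z w d
    assume T: "(x, y, z) \<in> composition_triples F G" and x: "x \<in> ball xb r" and y: "y \<in> ball yb r"
      and z: "z \<in> ball zb r" and w: "w \<in> ball zb r" and d: "0 < d" "d < r" and zw: "dist z w < d"
    have dC: "0 < d / C" "d / C < r / C" "0 < d / (L * C)" "d / (L * C) < r / (L * C)"
      using d C L by (auto simp: divide_strict_right_mono)
    obtain y' where y': "dist y y' < d / C" "w \<in> G (x, y')"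
      using R2[of "d / C" x y z w] T x y z zw R dC R_eq r parts C by auto
    obtain x' where x': "dist x x' < d / (L * C)" "y' \<in> F x'"
      using R3[of "d / (L * C)" x y y'] T x y y'(1) R dC R_eq r parts C L by auto
    have "x' \<in> ball xb R" "y' \<in> ball yb R"
      using x y x'(1) y'(1) dist_triangle[of xb x' x] dist_triangle[of yb y' y] dC R_eq parts by auto
    then obtain z' where z': "z' \<in> G (x', y')" "dist z' w \<le> D * dist x x'"
      using R1[of x x' y' w] y'(2) x w R R_eq parts by fastforce
    have "D * dist x x' \<le> D * (d / (L * C))" using x' D by (intro mult_left_mono) auto
    then have "dist z' w \<le> D / (L * C) * d" using z'(2) by simp
    then show "\<exists>x' y' z'. (x', y', z') \<in> composition_triples F G \<and> dist x x' \<le> d / (L * C) \<and>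
        dist y y' \<le> 1 / C * d \<and> dist z' w \<le> D / (L * C) * d"
      using x' y' z' by (intro exI[of _ x'] exI[of _ y'] exI[of _ z']) auto
  qed
qed

text \<open>
  Here \<open>x\<close> moves first (openness of \<open>G\<close>), the Lipschitz property of \<open>F\<close> restores \<open>y' \<in> F x'\<close>, and
  moving \<open>y\<close> spoils the equation \<open>w \<in> G (x', y)\<close> by at most \<open>D\<close> times the displacement.
\<close>

lemma composition_open_of_lipschitz_inner:
  fixes F :: "'x::banach \<Rightarrow> 'y::banach set" and G :: "'x \<times> 'y \<Rightarrow> 'z::banach set"
    and xb :: 'x and yb :: 'y and zb :: 'z
  assumes closed: "locally_closed_around (mf_graph F) (xb, yb)"
      "locally_closed_around (mf_graph G) ((xb, yb), zb)"
    and C: "0 < C" "open_at_linear_rate_fst G xb yb zb C"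
    and D: "0 \<le> D" "lipschitz_like_snd G xb yb zb D"
    and M: "0 < M" "lipschitz_like F xb yb M"
    and lt: "M * D < C"
  shows "\<exists>\<epsilon>>0. \<forall>\<rho>\<in>{0<..<\<epsilon>}. \<forall>(x, y, z) \<in> ball xb \<epsilon> \<times> ball yb \<epsilon> \<times> ball zb \<epsilon>.
    y \<in> F x \<and> z \<in> G (x, y) \<longrightarrow> ball z ((C - M * D) * \<rho>) \<subseteq> mf_image (mf_compose F G) (ball x \<rho>)"
proof -
  obtain R1 where "R1 > 0" and R1: "\<And>x y v z. x \<in> ball xb R1 \<Longrightarrow> y \<in> ball yb R1 \<Longrightarrow>
      v \<in> ball yb R1 \<Longrightarrow> z \<in> ball zb R1 \<Longrightarrow> z \<in> G (x, y) \<Longrightarrow> \<exists>z'\<in>G (x, v). dist z' z \<le> D * dist y v"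
    using lipschitz_like_sndD[OF D(2,1)] by blast
  obtain R2 where "R2 > 0" and R2: "\<And>\<rho> x y z w. 0 < \<rho> \<Longrightarrow> \<rho> < R2 \<Longrightarrow> x \<in> ball xb R2 \<Longrightarrow>
      y \<in> ball yb R2 \<Longrightarrow> z \<in> ball zb R2 \<Longrightarrow> z \<in> G (x, y) \<Longrightarrow> dist z w < \<rho> * C \<Longrightarrow>
      \<exists>x'. dist x x' < \<rho> \<and> w \<in> G (x', y)"
    using open_at_linear_rate_fstD[OF C(2)] by blast
  obtain R3 where "R3 > 0" and R3: "\<And>x u y. x \<in> ball xb R3 \<Longrightarrow> u \<in> ball xb R3 \<Longrightarrow>
      y \<in> ball yb R3 \<Longrightarrow> y \<in> F x \<Longrightarrow> \<exists>y'\<in>F u. dist y' y \<le> M * dist x u"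
    using lipschitz_likeD[OF M(2)] M(1) by fastforce
  define R where "R = min R1 (min R2 R3)"
  have R: "0 < R" "R \<le> R1" "R \<le> R2" "R \<le> R3"
    using \<open>R1 > 0\<close> \<open>R2 > 0\<close> \<open>R3 > 0\<close> by (auto simp: R_def)
  \<comment> \<open>Room for one correction: \<open>r\<close> plus a displacement \<open>r / C\<close> of \<open>x\<close> or \<open>M * r / C\<close> of \<open>y\<close>.\<close>
  define r where "r = R / (1 + 1 / C + M / C)"
  have den: "0 < 1 + 1 / C + M / C" using C M by (simp add: add_pos_pos)
  have r: "0 < r" using R den by (simp add: r_def)
  have "R = r * (1 + 1 / C + M / C)" using den by (simp add: r_def)
  then have R_eq: "R = r + r / C + M * (r / C)" by (simp add: algebra_simps)
  have parts: "0 < r / C" "0 < M * (r / C)" using r C M by auto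
  have MD: "0 \<le> M * D" using M D by simp
  show ?thesis
  proof (rule composition_open_of_correction[OF closed MD lt _ r, where K = "M / C"])
    show "0 \<le> M / C" using C M by simp
    fix x y z w d
    assume T: "(x, y, z) \<in> composition_triples F G" and x: "x \<in> ball xb r" and y: "y \<in> ball yb r"
      and z: "z \<in> ball zb r" and w: "w \<in> ball zb r" and d: "0 < d" "d < r" and zw: "dist z w < d"
    have dC: "0 < d / C" "d / C < r / C" using d C by (auto simp: divide_strict_right_mono)
    have MdC: "M * (d / C) < M * (r / C)" using dC(2) M(1) by (intro mult_strict_left_mono)
    obtain x' where x': "dist x x' < d / C" "w \<in> G (x', y)"
      using R2[of "d / C" x y z w] T x y z zw R dC R_eq r parts C by auto
    have x'R: "x' \<in> ball xb R"
      using x x'(1) dist_triangle[of xb x' x] dC R_eq parts by auto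
    then obtain y' where y': "y' \<in> F x'" "dist y' y \<le> M * dist x x'"
      using R3[of x x' y] T x y R R_eq parts by fastforce
    have "M * dist x x' \<le> M * (d / C)" using x' M by (intro mult_left_mono) auto
    then have yy': "dist y y' \<le> M * (d / C)" using y'(2) by (simp add: dist_commute)
    then have "y' \<in> ball yb R"
      using y dist_triangle[of yb y' y] MdC R_eq parts by auto
    then obtain z' where z': "z' \<in> G (x', y')" "dist z' w \<le> D * dist y y'"
      using R1[of x' y y' w] x'R x'(2) y w R R_eq parts by fastforce
    have "D * dist y y' \<le> D * (M * (d / C))" using yy' D by (intro mult_left_mono)
    then have "dist z' w \<le> M * D / C * d" using z'(2) by (simp add: mult_ac)
    then show "\<exists>x' y' z'. (x', y', z') \<in> composition_triples F G \<and> dist x x' \<le> d / C \<and>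
        dist y y' \<le> M / C * d \<and> dist z' w \<le> M * D / C * d"
      using x' y' yy' z' by (intro exI[of _ x'] exI[of _ y'] exI[of _ z']) auto
  qed
qed

section \<open>Localising the intermediate point\<close>

text \<open>
  The Lipschitz property carries \<open>zb \<in> G (xb, yb)\<close> to a point of \<open>G (x, yb)\<close> near \<open>zb\<close>, and
  openness in \<open>y\<close> at that point covers \<open>z\<close>.
\<close>

lemma nearby_witness:
  assumes zb: "zb \<in> G (xb, yb)"
    and D: "0 \<le> D" "lipschitz_like_fst G xb yb zb D"
    and C: "0 < C" "open_at_linear_rate_snd G xb yb zb C" and \<eta>: "0 < \<eta>"
  shows "\<exists>\<delta>>0. \<forall>x\<in>ball xb \<delta>. \<forall>z\<in>ball zb \<delta>. \<exists>y\<in>ball yb \<eta>. z \<in> G (x, y)"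
proof -
  obtain R1 where "R1 > 0" and R1: "\<And>x u y z. x \<in> ball xb R1 \<Longrightarrow> u \<in> ball xb R1 \<Longrightarrow>
      y \<in> ball yb R1 \<Longrightarrow> z \<in> ball zb R1 \<Longrightarrow> z \<in> G (x, y) \<Longrightarrow> \<exists>z'\<in>G (u, y). dist z' z \<le> D * dist x u"
    using lipschitz_like_fstD[OF D(2,1)] by blast
  obtain R2 where "R2 > 0" and R2: "\<And>\<rho> x y z w. 0 < \<rho> \<Longrightarrow> \<rho> < R2 \<Longrightarrow> x \<in> ball xb R2 \<Longrightarrow>
      y \<in> ball yb R2 \<Longrightarrow> z \<in> ball zb R2 \<Longrightarrow> z \<in> G (x, y) \<Longrightarrow> dist z w < \<rho> * C \<Longrightarrow>
      \<exists>y'. dist y y' < \<rho> \<and> w \<in> G (x, y')"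
    using open_at_linear_rate_sndD[OF C(2)] by blast
  define \<rho> where "\<rho> = min \<eta> R2 / 2"
  have \<rho>: "0 < \<rho>" "\<rho> < R2" "\<rho> < \<eta>" using \<open>R2 > 0\<close> \<eta> by (auto simp: \<rho>_def)
  define m where "m = min R1 (min R2 (\<rho> * C))"
  have m: "0 < m" "m \<le> R1" "m \<le> R2" "m \<le> \<rho> * C"
    using \<open>R1 > 0\<close> \<open>R2 > 0\<close> \<rho> C by (auto simp: m_def)
  \<comment> \<open>The point of \<open>G (x, yb)\<close> is within \<open>D * \<delta>\<close> of \<open>zb\<close>, hence within \<open>(1 + D) * \<delta>\<close> of \<open>z\<close>.\<close>
  define \<delta> where "\<delta> = m / (1 + D)"
  have \<delta>: "0 < \<delta>" using m D by (simp add: \<delta>_def)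
  have "m = \<delta> * (1 + D)" using D by (simp add: \<delta>_def)
  then have m_eq: "m = \<delta> + D * \<delta>" by (simp add: algebra_simps)
  have D\<delta>: "0 \<le> D * \<delta>" using D \<delta> by simp
  have "\<exists>y\<in>ball yb \<eta>. z \<in> G (x, y)" if x: "x \<in> ball xb \<delta>" and z: "z \<in> ball zb \<delta>" for x z
  proof -
    obtain z' where z': "z' \<in> G (x, yb)" "dist z' zb \<le> D * dist xb x"
      using R1[of xb x yb zb] zb x m m_eq D\<delta> \<open>R1 > 0\<close> by auto
    have "D * dist xb x \<le> D * \<delta>" using x D by (intro mult_left_mono) auto
    then have near: "dist zb z' \<le> D * \<delta>" using z'(2) by (simp add: dist_commute)
    then have "dist z' z < \<rho> * C"
      using z dist_triangle3[of z' z zb] m m_eq by simp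
    then obtain y where "dist yb y < \<rho>" "z \<in> G (x, y)"
      using R2[of \<rho> x yb z' z] \<rho> x z'(1) near m m_eq \<delta> D\<delta> \<open>R2 > 0\<close> by auto
    then show ?thesis using \<rho> by (intro bexI[of _ y]) auto
  qed
  with \<delta> show ?thesis by blast
qed

lemma lipschitz_around_singleton_near:
  assumes "lipschitz_around F xb yb M" and M: "0 < M" and F: "F xb = {yb}" and \<eta>: "0 < \<eta>"
  shows "\<exists>\<delta>>0. \<forall>x\<in>ball xb \<delta>. F x \<subseteq> ball yb \<eta>"
proof -
  obtain U where U: "xb \<in> interior U"
    and lip: "\<And>x u. x \<in> U \<Longrightarrow> u \<in> U \<Longrightarrow> F x \<subseteq> F u + scaled_unit_ball (M * norm (x - u))"
    using assms(1) unfolding lipschitz_around_def by blast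
  obtain r where r: "r > 0" "ball xb r \<subseteq> U"
    using ball_subset_of_interior[OF U] by blast
  have "dist yb y < \<eta>" if x: "x \<in> ball xb (min r (\<eta> / M))" and y: "y \<in> F x" for x y
  proof -
    have "y \<in> {yb} + scaled_unit_ball (M * norm (x - xb))"
    proof -
      have "x \<in> U" using x r(2) by auto
      moreover have "xb \<in> U" using r by auto
      ultimately show ?thesis using lip[of x xb] y F by auto
    qed
    then have "dist yb y \<le> M * norm (x - xb)"
      using mem_plus_scaled_unit_ballD[of y "{yb}"] M by auto
    also have "\<dots> < \<eta>"
      using x M by (simp add: dist_norm norm_minus_commute field_simps)
    finally show ?thesis .
  qed
  then show ?thesis
    using r M \<eta> by (intro exI[of _ "min r (\<eta> / M)"]) auto
qed

text \<open>
  The hypothesis \<open>near\<close> is what the two statements about the graph share: a witness \<open>y\<close> for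
  \<open>z \<in> (mf_compose F G) x\<close> cannot be far from \<open>yb\<close> once \<open>(x, z)\<close> is close to \<open>(xb, zb)\<close>.
\<close>

lemma openness_on_composition_graph:
  fixes c :: real
  assumes \<epsilon>: "0 < \<epsilon>"
    and triples: "\<forall>\<rho>\<in>{0<..<\<epsilon>}. \<forall>(x, y, z) \<in> ball xb \<epsilon> \<times> ball yb \<epsilon> \<times> ball zb \<epsilon>.
      y \<in> F x \<and> z \<in> G (x, y) \<longrightarrow> ball z (c * \<rho>) \<subseteq> mf_image (mf_compose F G) (ball x \<rho>)"
    and \<delta>: "0 < \<delta>"
    and near: "\<And>x y z. x \<in> ball xb (min \<epsilon> \<delta>) \<Longrightarrow> z \<in> ball zb (min \<epsilon> \<delta>) \<Longrightarrow> y \<in> F x \<Longrightarrow>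
      z \<in> G (x, y) \<Longrightarrow> y \<in> ball yb \<epsilon>"
  shows "\<exists>\<epsilon>'>0. \<forall>\<rho>\<in>{0<..<\<epsilon>'}. \<forall>(x, z) \<in> mf_graph (mf_compose F G) \<inter> ball xb \<epsilon>' \<times> ball zb \<epsilon>'.
    ball z (c * \<rho>) \<subseteq> mf_image (mf_compose F G) (ball x \<rho>)"
proof (intro exI[of _ "min \<epsilon> \<delta>"] conjI ballI)
  fix \<rho> p
  assume \<rho>: "\<rho> \<in> {0<..<min \<epsilon> \<delta>}"
    and p: "p \<in> mf_graph (mf_compose F G) \<inter> ball xb (min \<epsilon> \<delta>) \<times> ball zb (min \<epsilon> \<delta>)"
  obtain x z y where xyz: "p = (x, z)" "y \<in> F x" "z \<in> G (x, y)"
    using p by (auto simp: mf_graph_def mf_compose_def)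
  have xz: "x \<in> ball xb (min \<epsilon> \<delta>)" "z \<in> ball zb (min \<epsilon> \<delta>)" using p xyz by auto
  have "(x, y, z) \<in> ball xb \<epsilon> \<times> ball yb \<epsilon> \<times> ball zb \<epsilon>"
    using xz near[OF xz xyz(2,3)] by auto
  moreover have "\<rho> \<in> {0<..<\<epsilon>}" using \<rho> by simp
  ultimately have "ball z (c * \<rho>) \<subseteq> mf_image (mf_compose F G) (ball x \<rho>)"
    using triples xyz(2,3) by fast
  then show "case p of (x, z) \<Rightarrow> ball z (c * \<rho>) \<subseteq> mf_image (mf_compose F G) (ball x \<rho>)"
    by (simp add: xyz(1))
qed (use \<epsilon> \<delta> in auto)

section \<open>Linear openness of the composition\<close>

theorem theorem3p5:
  fixes F :: "'x::banach \<Rightarrow> 'y::banach set"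
    and G :: "'x \<times> 'y \<Rightarrow> 'z::banach set"
    and \<Phi> :: "'x \<Rightarrow> 'z set"
    and xb :: 'x and yb :: 'y and zb :: 'z
  assumes F_pt: "(xb, yb) \<in> mf_graph F"
    and G_pt: "((xb, yb), zb) \<in> mf_graph G"
    and F_closed: "locally_closed_around (mf_graph F) (xb, yb)"
    and G_closed: "locally_closed_around (mf_graph G) ((xb, yb), zb)"
    and Phi: "\<Phi> = mf_compose F G"
  shows
    "(\<forall>C D L :: real.
        D \<ge> 0 \<and> lipschitz_like_fst G xb yb zb D \<and>
        C > 0 \<and> open_at_linear_rate_snd G xb yb zb C \<and>
        L > 0 \<and> open_at_linear_rate F xb yb L \<and>
        L * C - D > 0 \<longrightarrow>
        (\<exists>\<epsilon>>0.
          (\<forall>\<rho>\<in>{0<..<\<epsilon>}. \<forall>(x, y, z) \<in> ball xb \<epsilon> \<times> ball yb \<epsilon> \<times> ball zb \<epsilon>.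
            y \<in> F x \<and> z \<in> G (x, y) \<longrightarrow>
            ball z ((L * C - D) * \<rho>) \<subseteq> mf_image \<Phi> (ball x \<rho>)) \<and>
          ((\<forall>x\<in>ball xb \<epsilon>. \<forall>y y'. y \<noteq> y' \<longrightarrow> G (x, y) \<inter> G (x, y') = {}) \<longrightarrow>
            (\<exists>\<epsilon>'>0. \<forall>\<rho>\<in>{0<..<\<epsilon>'}.
              \<forall>(x, z) \<in> mf_graph \<Phi> \<inter> ball xb \<epsilon>' \<times> ball zb \<epsilon>'.
                ball z ((L * C - D) * \<rho>) \<subseteq> mf_image \<Phi> (ball x \<rho>)))))
     \<and>
     (\<forall>C D M :: real.
        C > 0 \<and> open_at_linear_rate_fst G xb yb zb C \<and>
        D \<ge> 0 \<and> lipschitz_like_snd G xb yb zb D \<and>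
        M > 0 \<and> lipschitz_like F xb yb M \<and>
        C - M * D > 0 \<longrightarrow>
        (\<exists>\<epsilon>>0. \<forall>\<rho>\<in>{0<..<\<epsilon>}. \<forall>(x, y, z) \<in> ball xb \<epsilon> \<times> ball yb \<epsilon> \<times> ball zb \<epsilon>.
            y \<in> F x \<and> z \<in> G (x, y) \<longrightarrow>
            ball z ((C - M * D) * \<rho>) \<subseteq> mf_image \<Phi> (ball x \<rho>)) \<and>
        (lipschitz_around F xb yb M \<and> F xb = {yb} \<longrightarrow>
          (\<exists>\<epsilon>>0. \<forall>\<rho>\<in>{0<..<\<epsilon>}.
            \<forall>(x, z) \<in> mf_graph \<Phi> \<inter> ball xb \<epsilon> \<times> ball zb \<epsilon>.
              ball z ((C - M * D) * \<rho>) \<subseteq> mf_image \<Phi> (ball x \<rho>))))"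
proof (intro conjI allI impI; elim conjE)
  fix C D L :: real
  assume *: "0 \<le> D" "lipschitz_like_fst G xb yb zb D" "0 < C" "open_at_linear_rate_snd G xb yb zb C"
    "0 < L" "open_at_linear_rate F xb yb L" "0 < L * C - D"
  have "D < L * C" using *(7) by simp
  then obtain \<epsilon> where \<epsilon>: "0 < \<epsilon>" and triples: "\<forall>\<rho>\<in>{0<..<\<epsilon>}.
      \<forall>(x, y, z) \<in> ball xb \<epsilon> \<times> ball yb \<epsilon> \<times> ball zb \<epsilon>. y \<in> F x \<and> z \<in> G (x, y) \<longrightarrow>
      ball z ((L * C - D) * \<rho>) \<subseteq> mf_image (mf_compose F G) (ball x \<rho>)"
    using composition_open_of_open_inner[OF F_closed G_closed *(1-6)] by blast
  have zb: "zb \<in> G (xb, yb)" using G_pt by (simp add: mf_graph_def)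
  obtain \<delta> where \<delta>: "0 < \<delta>"
    and witness: "\<And>x z. x \<in> ball xb \<delta> \<Longrightarrow> z \<in> ball zb \<delta> \<Longrightarrow> \<exists>y\<in>ball yb \<epsilon>. z \<in> G (x, y)"
    using nearby_witness[where G = G, OF zb *(1-4) \<epsilon>] by blast
  have graph: "\<exists>\<epsilon>'>0. \<forall>\<rho>\<in>{0<..<\<epsilon>'}. \<forall>(x, z) \<in> mf_graph (mf_compose F G) \<inter> ball xb \<epsilon>' \<times> ball zb \<epsilon>'.
      ball z ((L * C - D) * \<rho>) \<subseteq> mf_image (mf_compose F G) (ball x \<rho>)"
    if disj: "\<forall>x\<in>ball xb \<epsilon>. \<forall>y y'. y \<noteq> y' \<longrightarrow> G (x, y) \<inter> G (x, y') = {}"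
  proof (rule openness_on_composition_graph[OF \<epsilon> triples \<delta>])
    fix x y z
    assume x: "x \<in> ball xb (min \<epsilon> \<delta>)" and z: "z \<in> ball zb (min \<epsilon> \<delta>)" and y: "z \<in> G (x, y)"
    have "x \<in> ball xb \<delta>" "z \<in> ball zb \<delta>" "x \<in> ball xb \<epsilon>" using x z by auto
    then obtain y' where y': "y' \<in> ball yb \<epsilon>" "z \<in> G (x, y')" using witness by blast
    then have "y = y'" using disj \<open>x \<in> ball xb \<epsilon>\<close> y by blast
    with y' show "y \<in> ball yb \<epsilon>" by simp
  qed
  show "\<exists>\<epsilon>>0.
      (\<forall>\<rho>\<in>{0<..<\<epsilon>}. \<forall>(x, y, z) \<in> ball xb \<epsilon> \<times> ball yb \<epsilon> \<times> ball zb \<epsilon>.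
        y \<in> F x \<and> z \<in> G (x, y) \<longrightarrow> ball z ((L * C - D) * \<rho>) \<subseteq> mf_image \<Phi> (ball x \<rho>)) \<and>
      ((\<forall>x\<in>ball xb \<epsilon>. \<forall>y y'. y \<noteq> y' \<longrightarrow> G (x, y) \<inter> G (x, y') = {}) \<longrightarrow>
        (\<exists>\<epsilon>'>0. \<forall>\<rho>\<in>{0<..<\<epsilon>'}. \<forall>(x, z) \<in> mf_graph \<Phi> \<inter> ball xb \<epsilon>' \<times> ball zb \<epsilon>'.
          ball z ((L * C - D) * \<rho>) \<subseteq> mf_image \<Phi> (ball x \<rho>)))"
    unfolding Phi by (intro exI[of _ \<epsilon>] conjI impI \<epsilon> triples graph)
next
  fix C D M :: real
  assume *: "0 < C" "open_at_linear_rate_fst G xb yb zb C" "0 \<le> D" "lipschitz_like_snd G xb yb zb D"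
    "0 < M" "lipschitz_like F xb yb M" "0 < C - M * D"
  have "M * D < C" using *(7) by simp
  then show "\<exists>\<epsilon>>0. \<forall>\<rho>\<in>{0<..<\<epsilon>}. \<forall>(x, y, z) \<in> ball xb \<epsilon> \<times> ball yb \<epsilon> \<times> ball zb \<epsilon>.
      y \<in> F x \<and> z \<in> G (x, y) \<longrightarrow> ball z ((C - M * D) * \<rho>) \<subseteq> mf_image \<Phi> (ball x \<rho>)"
    unfolding Phi by (rule composition_open_of_lipschitz_inner[OF F_closed G_closed *(1-6)])
next
  fix C D M :: real
  assume *: "0 < C" "open_at_linear_rate_fst G xb yb zb C" "0 \<le> D" "lipschitz_like_snd G xb yb zb D"
    "0 < M" "lipschitz_like F xb yb M" "0 < C - M * D"
    and F: "lipschitz_around F xb yb M" "F xb = {yb}"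
  have "M * D < C" using *(7) by simp
  then obtain \<epsilon> where \<epsilon>: "0 < \<epsilon>" and triples: "\<forall>\<rho>\<in>{0<..<\<epsilon>}.
      \<forall>(x, y, z) \<in> ball xb \<epsilon> \<times> ball yb \<epsilon> \<times> ball zb \<epsilon>. y \<in> F x \<and> z \<in> G (x, y) \<longrightarrow>
      ball z ((C - M * D) * \<rho>) \<subseteq> mf_image (mf_compose F G) (ball x \<rho>)"
    using composition_open_of_lipschitz_inner[OF F_closed G_closed *(1-6)] by blast
  obtain \<delta> where \<delta>: "0 < \<delta>" "\<forall>x\<in>ball xb \<delta>. F x \<subseteq> ball yb \<epsilon>"
    using lipschitz_around_singleton_near[where F = F, OF F(1) *(5) F(2) \<epsilon>] by blast
  show "\<exists>\<epsilon>>0. \<forall>\<rho>\<in>{0<..<\<epsilon>}. \<forall>(x, z) \<in> mf_graph \<Phi> \<inter> ball xb \<epsilon> \<times> ball zb \<epsilon>.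
      ball z ((C - M * D) * \<rho>) \<subseteq> mf_image \<Phi> (ball x \<rho>)"
    unfolding Phi
    by (rule openness_on_composition_graph[OF \<epsilon> triples \<delta>(1)]) (use \<delta>(2) in fastforce)
qed

end
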